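(* Let $X$ be a quandle. If there exists a normal subgroup $G$ of $\mathrm{Aut}(X)$ that acts freely and transitively on $X$, then the quandle $X$ is isomorphic, as a quandle, to a generalized Alexander quandle.
   Context: A quandle is a non-empty set $X$ with a binary operation $\triangleleft$ such that (i) $x \triangleleft x = x$ for all $x$; (ii) for every $y \in X$ the map $s_y \colon X \to X$, $s_y(x) = x \triangleleft y$, is a bijection; (iii) $(x \triangleleft y)\triangleleft z = (x \triangleleft z)\triangleleft (y \triangleleft z)$ for all $x,y,z$. A quandle homomorphism is a map preserving $\triangleleft$, and a quandle isomorphism is a bijective quandle homomorphism. $\mathrm{Aut}(X)$ is the group of quandle isomorphisms $X\to X$ with product $fg := g \circ f$; it acts on $X$ from the right by $x\cdot f := f(x)$. For a group $G$ and an automorphism $\sigma$ of $G$, the generalized Alexander quandle $\mathrm{GAlex}(G,\sigma)$ is the set $G$ with the operation $x \triangleleft y := \sigma(xy^{-1})y$. *)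

theory Defs
  imports "HOL-Algebra.Bij" "HOL-Algebra.Coset"
begin

record 'a quandle_struct = "'a partial_object" +
  qop :: "['a, 'a] \<Rightarrow> 'a" (infixl \<open>\<triangleleft>\<index>\<close> 70)

locale quandle =
  fixes Q (structure)
  assumes nonempty: "carrier Q \<noteq> {}"
    and op_closed: "\<lbrakk>x \<in> carrier Q; y \<in> carrier Q\<rbrakk> \<Longrightarrow> x \<triangleleft> y \<in> carrier Q"
    and op_idem: "x \<in> carrier Q \<Longrightarrow> x \<triangleleft> x = x"
    and op_bij: "y \<in> carrier Q \<Longrightarrow> bij_betw (\<lambda>x. x \<triangleleft> y) (carrier Q) (carrier Q)"
    and op_distrib: "\<lbrakk>x \<in> carrier Q; y \<in> carrier Q; z \<in> carrier Q\<rbrakk>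
      \<Longrightarrow> (x \<triangleleft> y) \<triangleleft> z = (x \<triangleleft> z) \<triangleleft> (y \<triangleleft> z)"

definition quandle_hom ::
  "('a, 'm) quandle_struct_scheme \<Rightarrow> ('b, 'n) quandle_struct_scheme \<Rightarrow> ('a \<Rightarrow> 'b) set" where
  "quandle_hom Q R = {f \<in> carrier Q \<rightarrow> carrier R.
     \<forall>x \<in> carrier Q. \<forall>y \<in> carrier Q. f (x \<triangleleft>\<^bsub>Q\<^esub> y) = f x \<triangleleft>\<^bsub>R\<^esub> f y}"

definition quandle_iso ::
  "('a, 'm) quandle_struct_scheme \<Rightarrow> ('b, 'n) quandle_struct_scheme \<Rightarrow> ('a \<Rightarrow> 'b) set" where
  "quandle_iso Q R = {f \<in> quandle_hom Q R. bij_betw f (carrier Q) (carrier R)}"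

definition quandle_isomorphic ::
  "('a, 'm) quandle_struct_scheme \<Rightarrow> ('b, 'n) quandle_struct_scheme \<Rightarrow> bool" where
  "quandle_isomorphic Q R \<longleftrightarrow> quandle_iso Q R \<noteq> {}"

text \<open>
  As in \<^const>\<open>auto\<close> for groups, automorphisms are taken extensional so that each is
  represented by exactly one HOL function. The product of \<open>f\<close> and \<open>g\<close> is ``first \<open>f\<close>, then
  \<open>g\<close>'' (the opposite of \<^const>\<open>BijGroup\<close>), which makes evaluation a right action.
\<close>
definition quandle_Aut :: "('a, 'm) quandle_struct_scheme \<Rightarrow> ('a \<Rightarrow> 'a) monoid" where
  "quandle_Aut Q =
    \<lparr>carrier = quandle_iso Q Q \<inter> extensional (carrier Q),
     mult = (\<lambda>f g. compose (carrier Q) g f),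
     one = (\<lambda>x \<in> carrier Q. x)\<rparr>"

locale right_action = group G for G (structure) +
  fixes E :: "'e set" and act :: "'e \<Rightarrow> 'g \<Rightarrow> 'e"
  constrains G :: "('g, 'm) monoid_scheme"
  assumes act_closed: "\<lbrakk>x \<in> E; g \<in> carrier G\<rbrakk> \<Longrightarrow> act x g \<in> E"
    and act_one: "x \<in> E \<Longrightarrow> act x \<one> = x"
    and act_mult: "\<lbrakk>x \<in> E; g \<in> carrier G; h \<in> carrier G\<rbrakk>
      \<Longrightarrow> act x (g \<otimes> h) = act (act x g) h"

locale free_right_action = right_action +
  assumes free: "\<lbrakk>x \<in> E; g \<in> carrier G; act x g = x\<rbrakk> \<Longrightarrow> g = \<one>"

locale transitive_right_action = right_action +
  assumes transitive: "\<lbrakk>x \<in> E; y \<in> E\<rbrakk> \<Longrightarrow> \<exists>g \<in> carrier G. act x g = y"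

definition GAlex :: "('g, 'm) monoid_scheme \<Rightarrow> ('g \<Rightarrow> 'g) \<Rightarrow> 'g quandle_struct" where
  "GAlex G \<sigma> =
    \<lparr>carrier = carrier G,
     qop = (\<lambda>x y. \<sigma> (x \<otimes>\<^bsub>G\<^esub> inv\<^bsub>G\<^esub> y) \<otimes>\<^bsub>G\<^esub> y)\<rparr>"

lemma group_quandle_Aut:
  assumes "quandle Q"
  shows "group (quandle_Aut Q)"
proof -
  interpret quandle Q by fact
  let ?A = "quandle_iso Q Q \<inter> extensional (carrier Q)"
  have sub: "?A \<subseteq> Bij (carrier Q)"
    by (auto simp: quandle_iso_def Bij_def)
  show ?thesis
  proof (rule groupI)
    fix f g assume "f \<in> carrier (quandle_Aut Q)" "g \<in> carrier (quandle_Aut Q)"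
    then show "f \<otimes>\<^bsub>quandle_Aut Q\<^esub> g \<in> carrier (quandle_Aut Q)"
      by (auto simp: quandle_Aut_def quandle_iso_def quandle_hom_def compose_eq op_closed
          Pi_iff bij_betw_compose)
  next
    show "\<one>\<^bsub>quandle_Aut Q\<^esub> \<in> carrier (quandle_Aut Q)"
      using id_Bij[of "carrier Q"]
      by (auto simp: quandle_Aut_def quandle_iso_def quandle_hom_def op_closed Bij_def)
  next
    fix f g h
    assume "f \<in> carrier (quandle_Aut Q)" "g \<in> carrier (quandle_Aut Q)"
      "h \<in> carrier (quandle_Aut Q)"
    then show "f \<otimes>\<^bsub>quandle_Aut Q\<^esub> g \<otimes>\<^bsub>quandle_Aut Q\<^esub> h
        = f \<otimes>\<^bsub>quandle_Aut Q\<^esub> (g \<otimes>\<^bsub>quandle_Aut Q\<^esub> h)"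
      by (auto simp: quandle_Aut_def compose_def quandle_iso_def quandle_hom_def fun_eq_iff Pi_iff)
  next
    fix f assume "f \<in> carrier (quandle_Aut Q)"
    then show "\<one>\<^bsub>quandle_Aut Q\<^esub> \<otimes>\<^bsub>quandle_Aut Q\<^esub> f = f"
      by (auto simp: quandle_Aut_def compose_def extensional_def fun_eq_iff)
  next
    fix f assume f: "f \<in> carrier (quandle_Aut Q)"
    then have fA: "f \<in> ?A" by (simp add: quandle_Aut_def)
    with sub have fB: "f \<in> Bij (carrier Q)" by blast
    let ?g = "\<lambda>x \<in> carrier Q. inv_into (carrier Q) f x"
    have gB: "?g \<in> Bij (carrier Q)" by (rule restrict_inv_into_Bij [OF fB])
    have "inv_into (carrier Q) f (x \<triangleleft>\<^bsub>Q\<^esub> y)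
        = inv_into (carrier Q) f x \<triangleleft>\<^bsub>Q\<^esub> inv_into (carrier Q) f y"
      if "x \<in> carrier Q" "y \<in> carrier Q" for x y
      using fA fB that
      by (intro Bij_inv_into_lemma) (auto simp: quandle_iso_def quandle_hom_def op_closed)
    then have "?g \<in> carrier (quandle_Aut Q)"
      using gB
      by (auto simp: quandle_Aut_def quandle_iso_def quandle_hom_def Bij_def op_closed
          dest: bij_betwE)
    moreover have "?g \<otimes>\<^bsub>quandle_Aut Q\<^esub> f = \<one>\<^bsub>quandle_Aut Q\<^esub>"
      using fB by (auto simp: quandle_Aut_def compose_def Bij_def fun_eq_iff
          bij_betw_inv_into_right)
    ultimately show "\<exists>g \<in> carrier (quandle_Aut Q). g \<otimes>\<^bsub>quandle_Aut Q\<^esub> f = \<one>\<^bsub>quandle_Aut Q\<^esub>"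
      by blast
  qed
qed

lemma right_action_subgroup_quandle_Aut:
  assumes "quandle Q" and "subgroup G (quandle_Aut Q)"
  shows "right_action (quandle_Aut Q\<lparr>carrier := G\<rparr>) (carrier Q) (\<lambda>x f. f x)"
proof (intro right_action.intro right_action_axioms.intro)
  show "group (quandle_Aut Q\<lparr>carrier := G\<rparr>)"
    using assms by (intro subgroup.subgroup_is_group group_quandle_Aut)
next
  fix x g assume "x \<in> carrier Q" "g \<in> carrier (quandle_Aut Q\<lparr>carrier := G\<rparr>)"
  then show "g x \<in> carrier Q"
    using subgroup.subset [OF assms(2)]
    by (auto simp: quandle_Aut_def quandle_iso_def quandle_hom_def)
qed (auto simp: quandle_Aut_def compose_eq)

lemma quandle_GAlex:
  assumes "group G" and "\<sigma> \<in> auto G"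
  shows "quandle (GAlex G \<sigma>)"
proof -
  interpret group G by fact
  have s_hom: "\<sigma> \<in> hom G G" and s_bij: "bij_betw \<sigma> (carrier G) (carrier G)"
    using assms(2) by (auto simp: auto_def Bij_def)
  interpret s: group_hom G G \<sigma>
    by unfold_locales (rule s_hom)
  have cancel: "inv\<^bsub>G\<^esub> a \<otimes>\<^bsub>G\<^esub> (a \<otimes>\<^bsub>G\<^esub> b) = b" "a \<otimes>\<^bsub>G\<^esub> (inv\<^bsub>G\<^esub> a \<otimes>\<^bsub>G\<^esub> b) = b"
    if "a \<in> carrier G" "b \<in> carrier G" for a b
    using that by (simp_all flip: m_assoc)
  show ?thesis
  proof
    show "carrier (GAlex G \<sigma>) \<noteq> {}" by (auto simp: GAlex_def)
  next
    fix y assume "y \<in> carrier (GAlex G \<sigma>)"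
    then have y: "y \<in> carrier G" by (simp add: GAlex_def)
    have r: "bij_betw (\<lambda>x. x \<otimes>\<^bsub>G\<^esub> z) (carrier G) (carrier G)" if "z \<in> carrier G" for z
      by (rule bij_betw_byWitness[where f' = "\<lambda>x. x \<otimes>\<^bsub>G\<^esub> inv\<^bsub>G\<^esub> z"])
        (use that in \<open>auto simp: m_assoc\<close>)
    have "bij_betw ((\<lambda>x. x \<otimes>\<^bsub>G\<^esub> y) \<circ> (\<sigma> \<circ> (\<lambda>x. x \<otimes>\<^bsub>G\<^esub> inv\<^bsub>G\<^esub> y))) (carrier G) (carrier G)"
      by (rule bij_betw_trans [OF bij_betw_trans [OF r s_bij] r]) (use y in auto)
    then show "bij_betw (\<lambda>x. x \<triangleleft>\<^bsub>GAlex G \<sigma>\<^esub> y) (carrier (GAlex G \<sigma>)) (carrier (GAlex G \<sigma>))"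
      by (simp add: GAlex_def comp_def)
  qed (auto simp: GAlex_def m_assoc inv_mult_group cancel)
qed

end

theory Submission
  imports Defs
begin

text \<open>
  Fix a base point \<open>e\<close>. Since \<open>G\<close> acts freely and transitively, the orbit map \<open>g \<mapsto> g e\<close> is a
  bijection from \<open>G\<close> onto \<open>Q\<close> (\<open>bij_betw_orbit_map\<close>), so it only remains to read off the
  quandle operation on \<open>G\<close>. The symmetry \<open>s\<close> at \<open>e\<close>, \<open>s x = x \<triangleleft> e\<close>, is a quandle automorphism
  that fixes \<open>e\<close>. As \<open>G\<close> is normal, conjugation by \<open>s\<close> is an automorphism \<open>\<sigma>\<close> of \<open>G\<close>
  (\<open>conjugation_on_normal_auto\<close>), and \<open>\<sigma> g e = s (g (inv s e)) = g e \<triangleleft> e\<close>. Translating by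
  elements of \<open>G\<close>, which preserve the operation, moves this formula from \<open>e\<close> to all points:
  \<open>g e \<triangleleft> h e\<close> is the image under \<open>h\<close> of \<open>(g \<otimes> inv h) e \<triangleleft> e = \<sigma> (g \<otimes> inv h) e\<close>, that is,
  \<open>(\<sigma> (g \<otimes> inv h) \<otimes> h) e\<close>. Here products are read from left to right, as in the
  automorphism group.
\<close>

lemma conjugation_on_normal_auto:
  fixes G (structure)
  assumes "N \<lhd> G" and s: "s \<in> carrier G"
  shows "(\<lambda>g \<in> N. inv s \<otimes> g \<otimes> s) \<in> auto (G\<lparr>carrier := N\<rparr>)"
proof -
  interpret normal N G by fact
  have cancel: "inv s \<otimes> (s \<otimes> x) = x" "s \<otimes> (inv s \<otimes> x) = x" if "x \<in> carrier G" for x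
    using that s by (simp_all flip: m_assoc)
  have closed: "inv s \<otimes> (g \<otimes> s) \<in> N" "s \<otimes> (g \<otimes> inv s) \<in> N" if "g \<in> N" for g
    using that s inv_op_closed1[of s g] inv_op_closed2[of s g] by (simp_all add: m_assoc)
  have "bij_betw (\<lambda>g \<in> N. inv s \<otimes> g \<otimes> s) N N"
    by (rule bij_betw_byWitness[where f' = "\<lambda>g. s \<otimes> g \<otimes> inv s"])
      (use s in \<open>auto simp: closed m_assoc cancel\<close>)
  then show ?thesis
    using s by (auto simp: auto_def Bij_def hom_def closed m_assoc cancel)
qed

lemma bij_betw_orbit_map:
  assumes "free_right_action G E act" and "transitive_right_action G E act" and x: "x \<in> E"
  shows "bij_betw (act x) (carrier G) E"
proof -
  interpret free_right_action G E act by fact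
  interpret transitive_right_action G E act by fact
  have "g = h" if gh: "g \<in> carrier G" "h \<in> carrier G" and eq: "act x g = act x h" for g h
  proof -
    have "act x (g \<otimes>\<^bsub>G\<^esub> inv\<^bsub>G\<^esub> h) = act x (h \<otimes>\<^bsub>G\<^esub> inv\<^bsub>G\<^esub> h)"
      using gh x eq by (metis act_mult inv_closed)
    then have "g \<otimes>\<^bsub>G\<^esub> inv\<^bsub>G\<^esub> h = \<one>\<^bsub>G\<^esub>"
      using gh x by (intro free[OF x]) (simp_all add: act_one)
    then show ?thesis
      using gh by (metis inv_equality inv_closed inv_inv)
  qed
  then show ?thesis
    using x transitive[OF x] by (fastforce simp: bij_betw_def inj_on_def intro: act_closed)
qed

lemma quandle_iso_inv_into:
  assumes "quandle Q" and f: "f \<in> quandle_iso R Q"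
    and closed: "\<And>x y. \<lbrakk>x \<in> carrier R; y \<in> carrier R\<rbrakk> \<Longrightarrow> x \<triangleleft>\<^bsub>R\<^esub> y \<in> carrier R"
  shows "inv_into (carrier R) f \<in> quandle_iso Q R"
proof -
  interpret quandle Q by fact
  have bij: "bij_betw f (carrier R) (carrier Q)"
    and hom: "\<And>x y. \<lbrakk>x \<in> carrier R; y \<in> carrier R\<rbrakk> \<Longrightarrow> f (x \<triangleleft>\<^bsub>R\<^esub> y) = f x \<triangleleft>\<^bsub>Q\<^esub> f y"
    using f by (auto simp: quandle_iso_def quandle_hom_def)
  let ?g = "inv_into (carrier R) f"
  have gb: "bij_betw ?g (carrier Q) (carrier R)"
    using bij by (rule bij_betw_inv_into)
  then have g: "?g x \<in> carrier R" if "x \<in> carrier Q" for x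
    using that by (rule bij_betwE[THEN bspec])
  have "?g (x \<triangleleft>\<^bsub>Q\<^esub> y) = ?g x \<triangleleft>\<^bsub>R\<^esub> ?g y" if "x \<in> carrier Q" "y \<in> carrier Q" for x y
    using that bij
    by (intro inv_into_f_eq)
      (auto simp: bij_betw_def closed g hom bij_betw_inv_into_right[OF bij])
  with gb g show ?thesis
    by (auto simp: quandle_iso_def quandle_hom_def)
qed

text \<open>
  The second and third quandle axioms say exactly that right translations are automorphisms.
\<close>
lemma right_translation_in_quandle_Aut:
  assumes "quandle Q" and "y \<in> carrier Q"
  shows "(\<lambda>x \<in> carrier Q. x \<triangleleft>\<^bsub>Q\<^esub> y) \<in> carrier (quandle_Aut Q)"
proof -
  interpret quandle Q by fact
  have "bij_betw (\<lambda>x \<in> carrier Q. x \<triangleleft>\<^bsub>Q\<^esub> y) (carrier Q) (carrier Q)"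
    using op_bij[OF assms(2)] by (simp cong: bij_betw_cong)
  then show ?thesis
    using assms(2)
    by (auto simp: quandle_Aut_def quandle_iso_def quandle_hom_def op_closed intro: op_distrib)
qed

text \<open>
  A formula for \<open>\<triangleleft>\<close> with second argument \<open>e\<close> only fixes one right translation; it spreads over
  all of \<open>Q\<close> because an automorphism \<open>h\<close> satisfies \<open>h (x \<triangleleft> e) = h x \<triangleleft> h e\<close>.
\<close>
lemma quandle_op_conjugation:
  fixes Q (structure)
  defines "A \<equiv> quandle_Aut Q"
  assumes "quandle Q" and e: "e \<in> carrier Q" and gh: "g \<in> carrier A" "h \<in> carrier A"
  defines "s \<equiv> \<lambda>x \<in> carrier Q. x \<triangleleft> e"
  shows "(inv\<^bsub>A\<^esub> s \<otimes>\<^bsub>A\<^esub> (g \<otimes>\<^bsub>A\<^esub> inv\<^bsub>A\<^esub> h) \<otimes>\<^bsub>A\<^esub> s \<otimes>\<^bsub>A\<^esub> h) e = g e \<triangleleft> h e"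
proof -
  interpret quandle Q by fact
  interpret A: group A
    unfolding A_def using \<open>quandle Q\<close> by (rule group_quandle_Aut)
  have s: "s \<in> carrier A"
    unfolding A_def s_def using \<open>quandle Q\<close> e by (rule right_translation_in_quandle_Aut)
  have mult: "(f \<otimes>\<^bsub>A\<^esub> k) x = k (f x)" if "x \<in> carrier Q" for f k x
    using that by (simp add: A_def quandle_Aut_def compose_eq)
  have one: "\<one>\<^bsub>A\<^esub> x = x" if "x \<in> carrier Q" for x
    using that by (simp add: A_def quandle_Aut_def)
  have closed: "f x \<in> carrier Q" if "f \<in> carrier A" "x \<in> carrier Q" for f x
    using that by (auto simp: A_def quandle_Aut_def quandle_iso_def quandle_hom_def)
  have hom: "f (x \<triangleleft> y) = f x \<triangleleft> f y"
    if "f \<in> carrier A" "x \<in> carrier Q" "y \<in> carrier Q" for f x y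
    using that by (auto simp: A_def quandle_Aut_def quandle_iso_def quandle_hom_def)
  have inv_s_e: "(inv\<^bsub>A\<^esub> s) e = e"
  proof -
    have "(inv\<^bsub>A\<^esub> s) (s e) = e"
      using s e by (metis mult one A.r_inv)
    then show ?thesis using e by (simp add: s_def op_idem)
  qed
  have h_inv: "h ((inv\<^bsub>A\<^esub> h) (g e)) = g e"
    using gh e by (metis mult one closed A.l_inv)
  have "(inv\<^bsub>A\<^esub> s \<otimes>\<^bsub>A\<^esub> (g \<otimes>\<^bsub>A\<^esub> inv\<^bsub>A\<^esub> h) \<otimes>\<^bsub>A\<^esub> s \<otimes>\<^bsub>A\<^esub> h) e = h (s ((inv\<^bsub>A\<^esub> h) (g e)))"
    using e by (simp add: mult inv_s_e)
  also have "\<dots> = h ((inv\<^bsub>A\<^esub> h) (g e) \<triangleleft> e)"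
    using gh e by (simp add: s_def closed)
  also have "\<dots> = g e \<triangleleft> h e"
    using gh e by (simp add: hom closed h_inv)
  finally show ?thesis .
qed

theorem proposition4p2:
  fixes Q :: "'a quandle_struct"
  assumes "quandle Q"
    and "\<exists>G. G \<lhd> quandle_Aut Q
      \<and> free_right_action (quandle_Aut Q\<lparr>carrier := G\<rparr>) (carrier Q) (\<lambda>x f. f x)
      \<and> transitive_right_action (quandle_Aut Q\<lparr>carrier := G\<rparr>) (carrier Q) (\<lambda>x f. f x)"
  shows "\<exists>(H :: ('a \<Rightarrow> 'a) monoid) \<sigma>. group H \<and> \<sigma> \<in> auto H
      \<and> quandle_isomorphic Q (GAlex H \<sigma>)"
proof -
  let ?A = "quandle_Aut Q"
  obtain G where normal: "G \<lhd> ?A"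
    and free: "free_right_action (?A\<lparr>carrier := G\<rparr>) (carrier Q) (\<lambda>x f. f x)"
    and trans: "transitive_right_action (?A\<lparr>carrier := G\<rparr>) (carrier Q) (\<lambda>x f. f x)"
    using assms(2) by blast
  interpret normal G ?A by fact
  let ?H = "?A\<lparr>carrier := G\<rparr>"
  have H: "group ?H"
    by (rule subgroup_is_group) (rule group_quandle_Aut[OF assms(1)])
  obtain e where e: "e \<in> carrier Q"
    using quandle.nonempty[OF assms(1)] by blast
  define s where "s = (\<lambda>x \<in> carrier Q. x \<triangleleft>\<^bsub>Q\<^esub> e)"
  define \<sigma> where "\<sigma> = (\<lambda>g \<in> G. inv\<^bsub>?A\<^esub> s \<otimes>\<^bsub>?A\<^esub> g \<otimes>\<^bsub>?A\<^esub> s)"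
  have \<sigma>: "\<sigma> \<in> auto ?H"
    unfolding \<sigma>_def s_def
    by (intro conjugation_on_normal_auto normal right_translation_in_quandle_Aut assms(1) e)
  interpret R: quandle "GAlex ?H \<sigma>"
    using H \<sigma> by (rule quandle_GAlex)
  have bij: "bij_betw (\<lambda>g. g e) G (carrier Q)"
    using bij_betw_orbit_map[OF free trans e] by simp
  have op: "(g \<triangleleft>\<^bsub>GAlex ?H \<sigma>\<^esub> h) e = g e \<triangleleft>\<^bsub>Q\<^esub> h e" if gh: "g \<in> G" "h \<in> G" for g h
  proof -
    have "inv\<^bsub>?H\<^esub> h = inv\<^bsub>?A\<^esub> h"
      using gh by (intro m_inv_consistent subgroup_axioms)
    then show ?thesis
      using gh quandle_op_conjugation[OF assms(1) e, of g h]
      by (simp add: GAlex_def \<sigma>_def s_def)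
  qed
  have "(\<lambda>g. g e) \<in> quandle_iso (GAlex ?H \<sigma>) Q"
    using bij op bij_betwE[OF bij] by (simp add: quandle_iso_def quandle_hom_def GAlex_def)
  then have "quandle_isomorphic Q (GAlex ?H \<sigma>)"
    using quandle_iso_inv_into[OF assms(1) _ R.op_closed] unfolding quandle_isomorphic_def by blast
  with H \<sigma> show ?thesis by blast
qed

end
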